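(* Let $k\geq 2$ and let $P_k=\{u\in F_k \mid w(u)>0\}$ be the subset of the free group $F_k$ defined in the context, viewed as a set of reduced words over the alphabet $\Sigma_k^{\pm}$. Then $P_k$ is a context-free language over $\Sigma_k^{\pm}$, and $P_k$ is closed under word reversal, i.e., if $u\in P_k$ then $u^R\in P_k$.
   Context: Let $\Sigma_k=\{s_1,\dots,s_k\}$, let $F_k=F(\Sigma_k)$ be the free group on $\Sigma_k$, write $S_i=s_i^{-1}$, and let $\Sigma_k^{\pm}=\{s_1,\dots,s_k,S_1,\dots,S_k\}$. Elements of $F_k$ are identified with reduced words over $\Sigma_k^{\pm}$ (words with no two adjacent letters inverse to each other). For a reduced word $u$ define $$w(u)=\#\{\text{subwords of } u \text{ of the form } s_jS_i \text{ with } j>i\}-\#\{\text{subwords of } u \text{ of the form } S_js_i \text{ with } j>i\}+\tfrac12\,\epsilon(u),$$ where $\epsilon(u)=1$ if the last (rightmost) letter of $u$ is some $s_i$, $\epsilon(u)=-1$ if the last letter is some $S_i$, and $\epsilon(u)=0$ if $u$ is the empty word. A subword of length 2 is a pair of consecutive letters, and the numbers of subwords count occurrences. The set $P_k$ is the positive cone of a left order on $F_k$ (a total order invariant under left multiplication), given by $u>v \iff w(v^{-1}u)>0$. For a word $u=x_1x_2\cdots x_n$ with letters $x_i\in\Sigma_k^{\pm}$, its reversal is $u^R=x_n\cdots x_2x_1$ (letters are not inverted). *)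

theory Defs
  imports Complex_Main
begin

text \<open>Context-free grammars: nonterminals \<open>V\<close>, terminals \<open>T\<close>, productions \<open>P\<close>, start symbol \<open>S\<close>.\<close>

datatype ('n, 't) symbol = Nt 'n | Tm 't

type_synonym ('n, 't) production = "'n \<times> ('n, 't) symbol list"

definition cfg :: "'n set \<Rightarrow> 't set \<Rightarrow> ('n, 't) production set \<Rightarrow> 'n \<Rightarrow> bool" where
  "cfg V T P S \<longleftrightarrow> finite V \<and> finite T \<and> finite P \<and> S \<in> V
     \<and> P \<subseteq> V \<times> lists (Nt ` V \<union> Tm ` T)"

inductive derives1 ::
  "('n, 't) production set \<Rightarrow> ('n, 't) symbol list \<Rightarrow> ('n, 't) symbol list \<Rightarrow> bool"
  for P where
  "(A, \<alpha>) \<in> P \<Longrightarrow> derives1 P (\<beta> @ [Nt A] @ \<gamma>) (\<beta> @ \<alpha> @ \<gamma>)"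

definition generated_language :: "('n, 't) production set \<Rightarrow> 'n \<Rightarrow> 't list set" where
  "generated_language P S = {x. (derives1 P)\<^sup>*\<^sup>* [Nt S] (map Tm x)}"

text \<open>Taking the nonterminals to be natural numbers is no restriction, since a grammar
  has only finitely many of them.\<close>

definition context_free_language :: "'t set \<Rightarrow> 't list set \<Rightarrow> bool" where
  "context_free_language T L \<longleftrightarrow>
     (\<exists>(V :: nat set) P S. cfg V T P S \<and> generated_language P S = L)"

text \<open>\<open>Gen i\<close> is the letter \<open>s\<^sub>i\<close> and \<open>Inv i\<close> is the letter \<open>S\<^sub>i\<close>.\<close>

datatype letter = Gen nat | Inv nat

fun inverse_letter :: "letter \<Rightarrow> letter" where
  "inverse_letter (Gen i) = Inv i"
| "inverse_letter (Inv i) = Gen i"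

definition alphabet :: "nat \<Rightarrow> letter set" where
  "alphabet k = Gen ` {1..k} \<union> Inv ` {1..k}"

definition reduced :: "letter list \<Rightarrow> bool" where
  "reduced u \<longleftrightarrow> (\<forall>n. Suc n < length u \<longrightarrow> u ! Suc n \<noteq> inverse_letter (u ! n))"

text \<open>The underlying set of the free group \<open>F\<^sub>k\<close>; each element is represented by its
  reduced word.\<close>

definition free_group_words :: "nat \<Rightarrow> letter list set" where
  "free_group_words k = {u \<in> lists (alphabet k). reduced u}"

definition last_sign :: "letter list \<Rightarrow> real" where
  "last_sign u = (if u = [] then 0 else (case last u of Gen i \<Rightarrow> 1 | Inv i \<Rightarrow> - 1))"

definition weight :: "letter list \<Rightarrow> real" where
  "weight u =
     real (card {n. Suc n < length u \<and> (\<exists>i j. j > i \<and> u ! n = Gen j \<and> u ! Suc n = Inv i)})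
   - real (card {n. Suc n < length u \<and> (\<exists>i j. j > i \<and> u ! n = Inv j \<and> u ! Suc n = Gen i)})
   + 1 / 2 * last_sign u"

definition positive_cone :: "nat \<Rightarrow> letter list set" where
  "positive_cone k = {u \<in> free_group_words k. weight u > 0}"

end

theory Submission
  imports Defs
begin

text \<open>Reading a word from left to right, its weight is the value of an integer counter that
  each pair of adjacent letters changes by \<open>-1\<close>, \<open>0\<close> or \<open>1\<close>, corrected by half the sign of the
  last letter. A word is positive iff the counter is positive at the end, or is zero and the
  last letter is a generator. So the cone is accepted by an automaton with one integer counter
  whose states are the letters.

  Such a language is context-free. The nonterminals \<open>Exact c x y\<close> derive the words that lead from
  letter \<open>x\<close> to letter \<open>y\<close> and change the counter by exactly \<open>c\<close>. Three values of \<open>c\<close> suffice: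
  the counter moves by unit steps, so the intermediate value theorem for integers splits a
  word of net change in \<open>{-1, 0, 1}\<close> and length at least \<open>2\<close> into two nonempty words of net
  change in \<open>{-1, 0, 1}\<close> (lemma \<open>small_walk_split\<close>). From a word with a larger positive net change,
  prefixes of net change \<open>1\<close> are split off one after another. The grammar is sound because the languages of walks satisfy all its
  rules, and a grammar generates the least such family of languages.

  For reversal, let \<open>A, A'\<close> count the pairs \<open>s\<^sub>j S\<^sub>i\<close> with \<open>j > i\<close> and \<open>j < i\<close>, and \<open>B, B'\<close> the pairs
  \<open>S\<^sub>j s\<^sub>i\<close> with \<open>j > i\<close> and \<open>j < i\<close>. Reversal exchanges \<open>A\<close> with \<open>B'\<close> and \<open>B\<close> with \<open>A'\<close>, so the
  counter value changes by \<open>(A + A') - (B + B')\<close> up to sign. In a reduced word this difference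
  counts all changes from generators to inverses minus all changes back, hence it is
  determined by the signs of the first and the last letter, and the correction term
  compensates it exactly: the weight is invariant under reversal.\<close>


section \<open>Languages of grammars\<close>

definition rename :: "('m \<Rightarrow> 'n) \<Rightarrow> ('m, 't) symbol list \<Rightarrow> ('n, 't) symbol list" where
  "rename f = map (map_symbol f id)"

definition rename_production :: "('m \<Rightarrow> 'n) \<Rightarrow> ('m, 't) production \<Rightarrow> ('n, 't) production" where
  "rename_production f = (\<lambda>(A, \<alpha>). (f A, rename f \<alpha>))"

lemma rename_map_Tm [simp]: "rename f (map Tm x) = map Tm x"
  by (simp add: rename_def)

lemma derives1_rename:
  assumes "derives1 P \<alpha> \<beta>"
  shows "derives1 (rename_production f ` P) (rename f \<alpha>) (rename f \<beta>)"
  using assms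
proof cases
  case (1 A \<gamma> \<beta>\<^sub>1 \<beta>\<^sub>2)
  then have "(f A, rename f \<gamma>) \<in> rename_production f ` P"
    by (force simp: rename_production_def)
  from derives1.intros[OF this, of "rename f \<beta>\<^sub>1" "rename f \<beta>\<^sub>2"] 1 show ?thesis
    by (simp add: rename_def)
qed

lemma derives_rename:
  assumes "(derives1 P)\<^sup>*\<^sup>* \<alpha> \<beta>"
  shows "(derives1 (rename_production f ` P))\<^sup>*\<^sup>* (rename f \<alpha>) (rename f \<beta>)"
  using assms
  by (induction rule: rtranclp_induct) (auto intro: rtranclp.rtrancl_into_rtrancl derives1_rename)

lemma generated_language_rename:
  "generated_language P S \<subseteq> generated_language (rename_production f ` P) (f S)"
proof
  fix x assume "x \<in> generated_language P S"
  then show "x \<in> generated_language (rename_production f ` P) (f S)"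
    using derives_rename[of P "[Nt S]" "map Tm x" f]
    by (simp add: generated_language_def) (simp add: rename_def)
qed

text \<open>Renaming can be undone, so both inclusions of languages are instances of
  \<open>generated_language_rename\<close>.\<close>

lemma context_free_language_if_cfg:
  fixes V :: "'n set" and T :: "'t set"
  assumes "cfg V T P S"
  shows "context_free_language T (generated_language P S)"
proof -
  from assms have fin: "finite V" "finite T" "finite P" and S: "S \<in> V"
    and P: "P \<subseteq> V \<times> lists (Nt ` V \<union> Tm ` T)"
    by (auto simp: cfg_def)
  obtain f :: "'n \<Rightarrow> nat" where f: "inj_on f V"
    using finite_imp_inj_to_nat_seg[OF fin(1)] by blast
  define g where "g = inv_into V f"
  define P' where "P' = rename_production f ` P"
  have g: "g (f A) = A" if "A \<in> V" for A
    using f that by (simp add: g_def)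
  have inverse: "rename g (rename f \<alpha>) = \<alpha>" if "\<alpha> \<in> lists (Nt ` V \<union> Tm ` T)" for \<alpha> :: "('n, 't) symbol list"
    using that by (induction \<alpha>) (auto simp: rename_def g)
  have "rename_production g (rename_production f p) = p" if "p \<in> P" for p
  proof (cases p)
    case (Pair A \<alpha>)
    with that P have "A \<in> V" "\<alpha> \<in> lists (Nt ` V \<union> Tm ` T)"
      by blast+
    then show ?thesis
      using g inverse[of \<alpha>] Pair by (simp add: rename_production_def)
  qed
  then have "rename_production g ` P' = P"
    by (force simp: P'_def image_image)
  then have "generated_language P' (f S) \<subseteq> generated_language P S"
    using generated_language_rename[of P' "f S" g] g[OF S] by simp
  moreover have "generated_language P S \<subseteq> generated_language P' (f S)"
    unfolding P'_def by (rule generated_language_rename)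
  ultimately have language: "generated_language P' (f S) = generated_language P S"
    by (rule equalityI)
  have renamed: "rename f \<alpha> \<in> lists (Nt ` f ` V \<union> Tm ` T)"
    if "\<alpha> \<in> lists (Nt ` V \<union> Tm ` T)" for \<alpha> :: "('n, 't) symbol list"
    using that by (induction \<alpha>) (auto simp: rename_def)
  have "P' \<subseteq> f ` V \<times> lists (Nt ` f ` V \<union> Tm ` T)"
  proof
    fix p assume "p \<in> P'"
    then obtain A \<alpha> where "(A, \<alpha>) \<in> P" and p: "p = (f A, rename f \<alpha>)"
      by (auto simp: P'_def rename_production_def)
    with P have "A \<in> V" "\<alpha> \<in> lists (Nt ` V \<union> Tm ` T)"
      by blast+
    then show "p \<in> f ` V \<times> lists (Nt ` f ` V \<union> Tm ` T)"
      unfolding p using renamed by blast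
  qed
  moreover have "finite P'"
    using fin by (simp add: P'_def)
  ultimately have "cfg (f ` V) T P' (f S)"
    unfolding cfg_def using fin S by (intro conjI finite_imageI imageI)
  with language show ?thesis
    unfolding context_free_language_def by (intro exI conjI)
qed

fun form_language :: "('n \<Rightarrow> 't list set) \<Rightarrow> ('n, 't) symbol list \<Rightarrow> 't list set" where
  "form_language I [] = {[]}"
| "form_language I (Nt A # \<alpha>) = {u @ v | u v. u \<in> I A \<and> v \<in> form_language I \<alpha>}"
| "form_language I (Tm a # \<alpha>) = {a # v | v. v \<in> form_language I \<alpha>}"

lemma form_language_append_iff:
  "w \<in> form_language I (\<alpha> @ \<beta>) \<longleftrightarrow>
    (\<exists>u v. w = u @ v \<and> u \<in> form_language I \<alpha> \<and> v \<in> form_language I \<beta>)"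
proof (induction I \<alpha> arbitrary: w rule: form_language.induct)
  case (2 I A \<alpha>)
  have "w \<in> form_language I ((Nt A # \<alpha>) @ \<beta>) \<longleftrightarrow>
      (\<exists>u v. w = u @ v \<and> u \<in> I A \<and> v \<in> form_language I (\<alpha> @ \<beta>))"
    by simp
  also have "\<dots> \<longleftrightarrow> (\<exists>u a b. w = u @ (a @ b) \<and> u \<in> I A
      \<and> a \<in> form_language I \<alpha> \<and> b \<in> form_language I \<beta>)"
    unfolding 2 by blast
  also have "\<dots> \<longleftrightarrow> (\<exists>c b. w = c @ b \<and> (\<exists>u a. c = u @ a \<and> u \<in> I A
      \<and> a \<in> form_language I \<alpha>) \<and> b \<in> form_language I \<beta>)"
    unfolding append_assoc[symmetric] by blast
  finally show ?case
    by simp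
next
  case (3 I a \<alpha>)
  have "w \<in> form_language I ((Tm a # \<alpha>) @ \<beta>) \<longleftrightarrow>
      (\<exists>v. w = a # v \<and> v \<in> form_language I (\<alpha> @ \<beta>))"
    by simp
  also have "\<dots> \<longleftrightarrow> (\<exists>u b. w = (a # u) @ b \<and> u \<in> form_language I \<alpha> \<and> b \<in> form_language I \<beta>)"
    unfolding 3 append_Cons by blast
  also have "\<dots> \<longleftrightarrow> (\<exists>c b. w = c @ b \<and> (\<exists>u. c = a # u \<and> u \<in> form_language I \<alpha>)
      \<and> b \<in> form_language I \<beta>)"
    by blast
  finally show ?case
    by simp
qed simp

lemma form_language_map_Tm [simp]: "form_language I (map Tm x) = {x}"
  by (induction x) auto

text \<open>The languages generated by a grammar form the least solution of the inclusions that its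
  productions express. Minimality gives soundness of a grammar, being a solution gives
  completeness.\<close>

lemma generated_language_least:
  assumes closed: "\<And>A \<alpha>. (A, \<alpha>) \<in> P \<Longrightarrow> form_language I \<alpha> \<subseteq> I A"
  shows "generated_language P S \<subseteq> I S"
proof
  have step: "form_language I \<beta> \<subseteq> form_language I \<alpha>" if "derives1 P \<alpha> \<beta>" for \<alpha> \<beta>
    using that
  proof cases
    case (1 A \<gamma> \<beta>\<^sub>1 \<beta>\<^sub>2)
    then show ?thesis
      using closed[of A \<gamma>] by (simp add: subset_iff form_language_append_iff del: append_Cons) blast
  qed
  have steps: "form_language I \<beta> \<subseteq> form_language I \<alpha>" if "(derives1 P)\<^sup>*\<^sup>* \<alpha> \<beta>" for \<alpha> \<beta>
    using that by (induction rule: rtranclp_induct) (use step in blast)+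
  fix x assume "x \<in> generated_language P S"
  then show "x \<in> I S"
    using steps[of "[Nt S]" "map Tm x"] by (simp add: generated_language_def)
qed

lemma derives_context:
  assumes "(derives1 P)\<^sup>*\<^sup>* \<alpha> \<beta>"
  shows "(derives1 P)\<^sup>*\<^sup>* (\<gamma> @ \<alpha> @ \<delta>) (\<gamma> @ \<beta> @ \<delta>)"
  using assms
proof (induction rule: rtranclp_induct)
  case (step \<beta>\<^sub>1 \<beta>\<^sub>2)
  have "derives1 P (\<gamma> @ \<beta>\<^sub>1 @ \<delta>) (\<gamma> @ \<beta>\<^sub>2 @ \<delta>)"
    using step(2)
  proof cases
    case (1 A \<alpha>' \<xi> \<eta>)
    then show ?thesis
      using derives1.intros[of A \<alpha>' P "\<gamma> @ \<xi>" "\<eta> @ \<delta>"] by simp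
  qed
  with step.IH show ?case
    by simp
qed simp

lemma derives_if_form_language:
  "x \<in> form_language (generated_language P) \<alpha> \<Longrightarrow> (derives1 P)\<^sup>*\<^sup>* \<alpha> (map Tm x)"
proof (induction "generated_language P" \<alpha> arbitrary: x rule: form_language.induct)
  case (2 A \<alpha>)
  then obtain u v where x: "x = u @ v" and u: "(derives1 P)\<^sup>*\<^sup>* [Nt A] (map Tm u)"
    and v: "(derives1 P)\<^sup>*\<^sup>* \<alpha> (map Tm v)"
    by (auto simp: generated_language_def)
  from derives_context[OF u, of "[]" \<alpha>] derives_context[OF v, of "map Tm u" "[]"]
  show ?case
    unfolding x by simp
next
  case (3 a \<alpha>)
  then obtain v where x: "x = a # v" and v: "(derives1 P)\<^sup>*\<^sup>* \<alpha> (map Tm v)"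
    by auto
  from derives_context[OF v, of "[Tm a]" "[]"] show ?case
    unfolding x by simp
qed simp

lemma generated_language_closed:
  assumes "(A, \<alpha>) \<in> P"
  shows "form_language (generated_language P) \<alpha> \<subseteq> generated_language P A"
proof
  fix x assume "x \<in> form_language (generated_language P) \<alpha>"
  then have "(derives1 P)\<^sup>*\<^sup>* \<alpha> (map Tm x)"
    by (rule derives_if_form_language)
  moreover have "derives1 P [Nt A] \<alpha>"
    using derives1.intros[OF assms, of "[]" "[]"] by simp
  ultimately show "x \<in> generated_language P A"
    by (simp add: generated_language_def)
qed


section \<open>Walks with an integer counter\<close>

fun path_sum :: "('a \<Rightarrow> 'a \<Rightarrow> int) \<Rightarrow> 'a list \<Rightarrow> int" where
  "path_sum d (x # y # zs) = d x y + path_sum d (y # zs)"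
| "path_sum d _ = 0"

lemma path_sum_append:
  "path_sum d (x # p @ q) = path_sum d (x # p) + path_sum d (last (x # p) # q)"
  by (induction p arbitrary: x) auto

lemma successively_append_last:
  "successively E (x # p @ q) \<longleftrightarrow> successively E (x # p) \<and> successively E (last (x # p) # q)"
  by (induction p arbitrary: x) auto

lemma last_append_last: "last (x # p @ q) = last (last (x # p) # q)"
  by (induction p arbitrary: x) auto

text \<open>The states of the automaton are the letters of the finite set \<open>A\<close>, a word moves through
  the states that it spells, \<open>E\<close> says which letters may follow each other, \<open>d\<close> is the change of
  the counter, and \<open>F\<close> is the set of letters at which the final counter value \<open>0\<close> is accepted.\<close>

locale counter_walk =
  fixes A :: "'a set" and E :: "'a \<Rightarrow> 'a \<Rightarrow> bool" and d :: "'a \<Rightarrow> 'a \<Rightarrow> int" and F :: "'a set"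
  assumes finite_A: "finite A" and F_subset: "F \<subseteq> A" and unit_step: "\<bar>d x y\<bar> \<le> 1"
begin

definition accepted :: "'a list set" where
  "accepted = {u \<in> lists A. u \<noteq> [] \<and> successively E u
     \<and> (path_sum d u > 0 \<or> path_sum d u = 0 \<and> last u \<in> F)}"

lemma walk_intermediate_value:
  assumes "min 0 (path_sum d (x # v)) \<le> m" "m \<le> max 0 (path_sum d (x # v))"
  obtains p q where "v = p @ q" "path_sum d (x # p) = m"
proof -
  have "\<exists>p q. v = p @ q \<and> path_sum d (x # p) = m"
    using assms
  proof (induction v rule: rev_induct)
    case (snoc y v)
    let ?t = "path_sum d (x # v)"
    show ?case
    proof (cases "min 0 ?t \<le> m \<and> m \<le> max 0 ?t")
      case True
      with snoc.IH obtain p q where "v = p @ q" "path_sum d (x # p) = m"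
        by blast
      then have "v @ [y] = p @ (q @ [y])" "path_sum d (x # p) = m"
        by simp_all
      then show ?thesis
        by blast
    next
      case False
      have "path_sum d (x # v @ [y]) = ?t + d (last (x # v)) y"
        by (simp add: path_sum_append)
      with False snoc.prems unit_step[of "last (x # v)" y] have "path_sum d (x # v @ [y]) = m"
        by linarith
      then show ?thesis
        by (intro exI[of _ "v @ [y]"] exI[of _ "[]"]) simp
    qed
  qed auto
  with that show thesis
    by blast
qed

text \<open>Splitting off the first letter fails only if its step and the total are \<open>1\<close> and \<open>-1\<close> in some
  order. In that case the counter must return to its initial value on the way.\<close>

lemma small_walk_split:
  assumes "path_sum d (x # y # z # v) = c" "\<bar>c\<bar> \<le> 1"
  obtains p q where "y # z # v = p @ q" "p \<noteq> []" "q \<noteq> []"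
    "\<bar>path_sum d (x # p)\<bar> \<le> 1" "\<bar>path_sum d (last (x # p) # q)\<bar> \<le> 1"
proof (cases "\<bar>c - d x y\<bar> \<le> 1")
  case True
  with assms unit_step[of x y] show thesis
    by (intro that[of "[y]" "z # v"]) auto
next
  case False
  from assms have rest: "path_sum d (y # z # v) = c - d x y"
    by simp
  have "min 0 (path_sum d (y # z # v)) \<le> - d x y" "- d x y \<le> max 0 (path_sum d (y # z # v))"
    unfolding rest using False assms(2) unit_step[of x y] by linarith+
  then obtain p q where pq: "z # v = p @ q" and p: "path_sum d (y # p) = - d x y"
    by (rule walk_intermediate_value)
  have total: "path_sum d (last (y # p) # q) = c"
    using path_sum_append[of d y p q] rest p pq by simp
  have "q \<noteq> []"
    using total False unit_step[of x y] by auto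
  with pq p total assms(2) show thesis
    by (intro that[of "y # p" q]) auto
qed

end

datatype 'a walk_symbol = Start | Exact int 'a 'a | Positive 'a

context counter_walk
begin

definition nonterminals :: "'a walk_symbol set" where
  "nonterminals = {Start} \<union> (\<Union>c \<in> {-1..1}. \<Union>x \<in> A. Exact c x ` A) \<union> Positive ` A"

inductive_set rules :: "('a walk_symbol, 'a) production set" where
  start_positive: "x \<in> A \<Longrightarrow> (Start, [Tm x, Nt (Positive x)]) \<in> rules"
| start_zero: "x \<in> A \<Longrightarrow> y \<in> F \<Longrightarrow> (Start, [Tm x, Nt (Exact 0 x y)]) \<in> rules"
| empty: "x \<in> A \<Longrightarrow> (Exact 0 x x, []) \<in> rules"
| letter: "x \<in> A \<Longrightarrow> y \<in> A \<Longrightarrow> E x y \<Longrightarrow> (Exact (d x y) x y, [Tm y]) \<in> rules"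
| split: "x \<in> A \<Longrightarrow> y \<in> A \<Longrightarrow> z \<in> A \<Longrightarrow> \<bar>a\<bar> \<le> 1 \<Longrightarrow> \<bar>b\<bar> \<le> 1 \<Longrightarrow> \<bar>a + b\<bar> \<le> 1
    \<Longrightarrow> (Exact (a + b) x z, [Nt (Exact a x y), Nt (Exact b y z)]) \<in> rules"
| positive_one: "x \<in> A \<Longrightarrow> y \<in> A \<Longrightarrow> (Positive x, [Nt (Exact 1 x y)]) \<in> rules"
| positive_more: "x \<in> A \<Longrightarrow> y \<in> A
    \<Longrightarrow> (Positive x, [Nt (Exact 1 x y), Nt (Positive y)]) \<in> rules"

lemma nonterminals_iff [simp]:
  "Start \<in> nonterminals"
  "Exact c x y \<in> nonterminals \<longleftrightarrow> \<bar>c\<bar> \<le> 1 \<and> x \<in> A \<and> y \<in> A"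
  "Positive x \<in> nonterminals \<longleftrightarrow> x \<in> A"
  by (auto simp: nonterminals_def image_iff abs_le_iff)

lemma finite_nonterminals: "finite nonterminals"
  by (simp add: nonterminals_def finite_A)

lemma cfg_rules: "cfg nonterminals A rules Start"
proof -
  let ?X = "Nt ` nonterminals \<union> Tm ` A"
  have left: "N \<in> nonterminals" if "(N, \<alpha>) \<in> rules" for N \<alpha>
    using that by cases (simp_all add: unit_step)
  have right: "\<alpha> \<in> lists ?X" if "(N, \<alpha>) \<in> rules" for N \<alpha>
    using that by cases (use F_subset in auto)
  have length: "length \<alpha> \<le> 2" if "(N, \<alpha>) \<in> rules" for N \<alpha>
    using that by cases simp_all
  have rules: "rules \<subseteq> nonterminals \<times> lists ?X"
    by (intro subrelI SigmaI left right)
  have "rules \<subseteq> nonterminals \<times> {\<alpha>. set \<alpha> \<subseteq> ?X \<and> length \<alpha> \<le> 2}"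
    using rules length by (intro subrelI SigmaI left) auto
  moreover have "finite \<dots>"
    using finite_nonterminals finite_A by (simp add: finite_lists_length_le)
  ultimately have "finite rules"
    by (rule finite_subset)
  then show ?thesis
    using rules by (simp add: cfg_def finite_nonterminals finite_A)
qed

fun walks :: "'a walk_symbol \<Rightarrow> 'a list set" where
  "walks Start = accepted"
| "walks (Exact c x y) =
     {v \<in> lists A. successively E (x # v) \<and> last (x # v) = y \<and> path_sum d (x # v) = c}"
| "walks (Positive x) = {v \<in> lists A. successively E (x # v) \<and> path_sum d (x # v) > 0}"

lemma walks_closed:
  assumes "(N, \<alpha>) \<in> rules"
  shows "form_language walks \<alpha> \<subseteq> walks N"
proof
  note append = path_sum_append successively_append_last last_append_last
  fix w assume w: "w \<in> form_language walks \<alpha>"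
  from assms show "w \<in> walks N"
  proof cases
    case (split x y z a b)
    from w obtain u v where "w = u @ v" "u \<in> walks (Exact a x y)" "v \<in> walks (Exact b y z)"
      by (auto simp: split(2) simp del: walks.simps)
    then show ?thesis
      unfolding split(1) by (simp add: append del: path_sum.simps last.simps)
  next
    case (positive_more x y)
    from w obtain u v where "w = u @ v" "u \<in> walks (Exact 1 x y)" "v \<in> walks (Positive y)"
      by (auto simp: positive_more(2) simp del: walks.simps)
    then show ?thesis
      unfolding positive_more(1) by (simp add: append del: path_sum.simps last.simps)
  qed (use w F_subset in \<open>auto simp: accepted_def\<close>)
qed

lemma exact_generated:
  assumes "v \<in> lists A" "x \<in> A" "successively E (x # v)" "\<bar>path_sum d (x # v)\<bar> \<le> 1"
  shows "v \<in> generated_language rules (Exact (path_sum d (x # v)) x (last (x # v)))"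
  using assms
proof (induction "length v" arbitrary: x v rule: less_induct)
  case less
  consider "v = []" | y where "v = [y]" | y z w where "v = y # z # w"
    by (metis neq_Nil_conv)
  then show ?case
  proof cases
    case 1
    then show ?thesis
      using generated_language_closed[OF empty] less.prems by simp
  next
    case 2
    then show ?thesis
      using generated_language_closed[OF letter] less.prems by simp
  next
    case 3
    from less.prems(4) obtain p q where v: "v = p @ q" and ne: "p \<noteq> []" "q \<noteq> []"
      and small: "\<bar>path_sum d (x # p)\<bar> \<le> 1" "\<bar>path_sum d (last (x # p) # q)\<bar> \<le> 1"
      unfolding 3 by (rule small_walk_split[OF refl])
    let ?y = "last (x # p)"
    have y: "?y \<in> A" and z: "last (?y # q) \<in> A"
      using less.prems(1,2) v ne by auto
    have p: "p \<in> generated_language rules (Exact (path_sum d (x # p)) x ?y)"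
      using less v ne small by (intro less.hyps) (auto simp: successively_append_last)
    have q: "q \<in> generated_language rules (Exact (path_sum d (?y # q)) ?y (last (?y # q)))"
      using less.prems v ne small y
      by (intro less.hyps) (auto simp: successively_append_last simp del: last.simps)
    have sum: "path_sum d (x # v) = path_sum d (x # p) + path_sum d (?y # q)"
      unfolding v by (rule path_sum_append)
    have last: "last (x # v) = last (?y # q)"
      unfolding v by (rule last_append_last)
    have "(Exact (path_sum d (x # v)) x (last (x # v)),
        [Nt (Exact (path_sum d (x # p)) x ?y),
         Nt (Exact (path_sum d (?y # q)) ?y (last (?y # q)))]) \<in> rules"
      unfolding sum last using less.prems(2,4) y z small
      by (intro split) (simp_all only: sum)
    from generated_language_closed[OF this] p q v show ?thesis
      by (auto simp del: last.simps path_sum.simps)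
  qed
qed

lemma positive_generated:
  assumes "v \<in> lists A" "x \<in> A" "successively E (x # v)" "path_sum d (x # v) > 0"
  shows "v \<in> generated_language rules (Positive x)"
  using assms
proof (induction "length v" arbitrary: x v rule: less_induct)
  case less
  have "min 0 (path_sum d (x # v)) \<le> 1" "1 \<le> max 0 (path_sum d (x # v))"
    using less.prems(4) by auto
  then obtain p q where v: "v = p @ q" and one: "path_sum d (x # p) = 1"
    by (rule walk_intermediate_value)
  let ?y = "last (x # p)"
  have ne: "p \<noteq> []"
    using one by auto
  have sum: "path_sum d (x # v) = 1 + path_sum d (?y # q)"
    unfolding v path_sum_append one ..
  have y: "?y \<in> A"
    using less.prems(1,2) v ne by auto
  have p: "p \<in> generated_language rules (Exact 1 x ?y)"
    using exact_generated[of p x] less.prems v one by (auto simp: successively_append_last)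
  show ?case
  proof (cases "path_sum d (?y # q) > 0")
    case True
    then have "q \<in> generated_language rules (Positive ?y)"
      using less.prems v ne y
      by (intro less.hyps) (auto simp: successively_append_last simp del: last.simps)
    with generated_language_closed[OF positive_more[OF less.prems(2) y]] p v show ?thesis
      by (auto simp del: last.simps)
  next
    case False
    with sum less.prems(4) have "path_sum d (x # v) = 1"
      by simp
    then have "v \<in> generated_language rules (Exact 1 x (last (x # v)))"
      using exact_generated[of v x] less.prems by simp
    moreover have "last (x # v) \<in> A"
      using less.prems(1,2) by auto
    ultimately show ?thesis
      using generated_language_closed[OF positive_one[OF less.prems(2)], of "last (x # v)"]
      by (auto simp del: last.simps)
  qed
qed

lemma generated_language_rules: "generated_language rules Start = accepted"
proof
  show "generated_language rules Start \<subseteq> accepted"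
    using generated_language_least[where I = walks and S = Start, OF walks_closed] by simp
  show "accepted \<subseteq> generated_language rules Start"
  proof
    fix u assume u: "u \<in> accepted"
    then obtain x v where u_eq: "u = x # v"
      by (cases u) (auto simp: accepted_def)
    with u have v: "v \<in> lists A" "x \<in> A" "successively E (x # v)"
      and "path_sum d (x # v) > 0 \<or> path_sum d (x # v) = 0 \<and> last (x # v) \<in> F"
      by (auto simp: accepted_def)
    then consider "path_sum d (x # v) > 0" | "path_sum d (x # v) = 0" "last (x # v) \<in> F"
      by blast
    then show "u \<in> generated_language rules Start"
    proof cases
      case 1
      with positive_generated[of v x] v generated_language_closed[OF start_positive[OF v(2)]]
      show ?thesis
        by (auto simp: u_eq simp del: path_sum.simps)
    next
      case 2
      with exact_generated[of v x] v generated_language_closed[OF start_zero[OF v(2) 2(2)]]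
      show ?thesis
        by (auto simp: u_eq simp del: last.simps)
    qed
  qed
qed

lemma context_free_accepted: "context_free_language A accepted"
  using context_free_language_if_cfg[OF cfg_rules] by (simp only: generated_language_rules)

end


section \<open>The weight as a counter\<close>

fun turn :: "letter \<Rightarrow> letter \<Rightarrow> int" where
  "turn (Gen j) (Inv i) = of_bool (j > i)"
| "turn (Inv j) (Gen i) = - of_bool (j > i)"
| "turn _ _ = 0"

fun sign :: "letter \<Rightarrow> int" where
  "sign (Gen i) = 1"
| "sign (Inv i) = -1"

lemma card_adjacent_Cons:
  "card {n. Suc n < length (x # y # zs) \<and> Q ((x # y # zs) ! n) ((x # y # zs) ! Suc n)}
   = of_bool (Q x y) + card {n. Suc n < length (y # zs) \<and> Q ((y # zs) ! n) ((y # zs) ! Suc n)}"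
  (is "card ?L = _ + card ?R")
proof -
  have fin: "finite ?R"
    by (rule finite_subset[of _ "{..<length (y # zs)}"]) auto
  have L: "?L = {n. n = 0 \<and> Q x y} \<union> Suc ` ?R"
  proof (intro set_eqI)
    fix n show "n \<in> ?L \<longleftrightarrow> n \<in> {n. n = 0 \<and> Q x y} \<union> Suc ` ?R"
      by (cases n) auto
  qed
  have "card ?L = card {n :: nat. n = 0 \<and> Q x y} + card (Suc ` ?R)"
    unfolding L by (rule card_Un_disjoint) (use fin in auto)
  also have "card (Suc ` ?R) = card ?R"
    by (simp add: card_image)
  finally show ?thesis
    by (cases "Q x y") auto
qed

lemma weight_eq: "weight u = path_sum turn u + last_sign u / 2"
proof -
  let ?N = "\<lambda>Q u. card {n. Suc n < length u \<and> Q (u ! n) (u ! Suc n)}"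
  let ?down = "\<lambda>x y. \<exists>i j. j > i \<and> x = Gen j \<and> y = Inv i"
  let ?up = "\<lambda>x y. \<exists>i j. j > i \<and> x = Inv j \<and> y = Gen i"
  have turn: "turn x y = of_bool (?down x y) - of_bool (?up x y)" for x y
    by (cases x; cases y) auto
  have "int (?N ?down u) - int (?N ?up u) = path_sum turn u"
  proof (induction "turn" u rule: path_sum.induct)
    case (1 x y zs)
    then show ?case
      unfolding card_adjacent_Cons[where Q = ?down] card_adjacent_Cons[where Q = ?up]
      by (simp add: turn)
  qed simp_all
  from arg_cong[OF this, of real_of_int] show ?thesis
    unfolding weight_def by simp
qed

lemma last_sign_eq: "u \<noteq> [] \<Longrightarrow> last_sign u = sign (last u)"
  by (cases "last u") (auto simp: last_sign_def)

lemma reduced_iff_successively: "reduced u \<longleftrightarrow> successively (\<lambda>x y. y \<noteq> inverse_letter x) u"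
  by (simp add: reduced_def successively_conv_nth)

lemma context_free_positive_cone: "context_free_language (alphabet k) (positive_cone k)"
proof -
  interpret counter_walk "alphabet k" "\<lambda>x y. y \<noteq> inverse_letter x" turn "alphabet k \<inter> range Gen"
  proof
    show "\<bar>turn x y\<bar> \<le> 1" for x y
      by (cases x; cases y) auto
  qed (simp_all add: alphabet_def)
  have pos: "weight u > 0 \<longleftrightarrow>
      u \<noteq> [] \<and> (path_sum turn u > 0 \<or> path_sum turn u = 0 \<and> last u \<in> alphabet k \<inter> range Gen)"
    if "u \<in> lists (alphabet k)" for u
  proof (cases "u = []")
    case True
    then show ?thesis
      by (simp add: weight_eq last_sign_def)
  next
    case False
    with that have "last u \<in> alphabet k"
      by auto
    then show ?thesis
      using False by (cases "last u") (auto simp: weight_eq last_sign_eq)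
  qed
  have "positive_cone k = accepted"
    unfolding positive_cone_def free_group_words_def accepted_def reduced_iff_successively
    using pos by blast
  then show ?thesis
    using context_free_accepted by simp
qed


section \<open>Reversal\<close>

text \<open>For distinct indices exactly one of \<open>j > i\<close> and \<open>i > j\<close> holds, so a change between a
  generator and an inverse moves the counter in exactly one of the two reading directions. Two
  letters of the same kind never move it, and their signs agree.\<close>

lemma turn_swap:
  assumes "y \<noteq> inverse_letter x"
  shows "2 * turn y x + sign x = 2 * turn x y + sign y"
  using assms by (cases x; cases y) auto

lemma path_sum_turn_rev:
  assumes "reduced (x # v)"
  shows "2 * path_sum turn (rev (x # v)) + sign x = 2 * path_sum turn (x # v) + sign (last (x # v))"
  using assms
proof (induction v arbitrary: x)
  case (Cons y v)
  have "path_sum turn (us @ [y, x]) = path_sum turn (us @ [y]) + turn y x" for us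
  proof (cases us)
    case (Cons z w)
    then show ?thesis
      using path_sum_append[of turn z "w @ [y]" "[x]"] by simp
  qed simp
  then have "path_sum turn (rev (x # y # v)) = path_sum turn (rev (y # v)) + turn y x"
    by simp
  moreover have "y \<noteq> inverse_letter x" "reduced (y # v)"
    using Cons.prems by (auto simp: reduced_iff_successively)
  ultimately show ?case
    using Cons.IH[of y] turn_swap[of y x] by simp
qed simp

lemma weight_rev:
  assumes "reduced u"
  shows "weight (rev u) = weight u"
proof (cases u)
  case (Cons x v)
  have "real_of_int (2 * path_sum turn (rev u) + sign x)
      = real_of_int (2 * path_sum turn u + sign (last u))"
    using path_sum_turn_rev[of x v] assms Cons by simp
  moreover have "last_sign (rev u) = sign x" "last_sign u = sign (last u)"
    by (simp_all add: last_sign_eq Cons)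
  ultimately show ?thesis
    by (simp add: weight_eq)
qed simp

lemma inverse_letter_inverse_letter: "inverse_letter (inverse_letter x) = x"
  by (cases x) auto

lemma reduced_rev: "reduced (rev u) \<longleftrightarrow> reduced u"
proof -
  have "x \<noteq> inverse_letter y \<longleftrightarrow> y \<noteq> inverse_letter x" for x y
    using inverse_letter_inverse_letter by metis
  then show ?thesis
    by (simp add: reduced_iff_successively)
qed

theorem mainTheorem3:
  fixes k :: nat
  assumes "k \<ge> 2"
  shows "context_free_language (alphabet k) (positive_cone k)
       \<and> (\<forall>u. u \<in> positive_cone k \<longrightarrow> rev u \<in> positive_cone k)"
proof
  show "\<forall>u. u \<in> positive_cone k \<longrightarrow> rev u \<in> positive_cone k"
    by (auto simp: positive_cone_def free_group_words_def reduced_rev weight_rev)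
qed (rule context_free_positive_cone)

end
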